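(* Consider the system $x_{t+1}=f(x_t)+Bu_t$ with $f(x)=AZ(x)$, the data matrices $U_0,Z_0,X_1$, and functions $L$, $\alpha_1,\dots,\alpha_N$, matrices $\mathcal L_1,\dots,\mathcal L_N$ and a set $\mathcal X\subseteq\mathbb R^n$ satisfying properties (i)–(iii), all as described in the context. Let $\mathcal I=\{1,\dots,N\}$ and fix a scalar $\delta\in\mathbb R$. Suppose there exist $R_i\in\mathbb R^{T\times S}$, $Q_i=Q_i^\top\succ0$ in $\mathbb R^{n\times n}$ for $i\in\mathcal I$, $M\in\mathbb R^{n\times n}$, $C_1\in\mathbb R^{(S-n)\times n}$ and an invertible $C_2\in\mathbb R^{(S-n)\times(S-n)}$ such that $$\begin{bmatrix}\mathrm{sym}\left(\begin{bmatrix}X_1\\ \mathcal L_iZ_0\end{bmatrix}R_i\begin{bmatrix}\delta I_n&0\\0&I_{S-n}\end{bmatrix}\right)+\begin{bmatrix}Q_j&0\\0&0\end{bmatrix}&\star\\ \left(\begin{bmatrix}X_1\\ \mathcal L_iZ_0\end{bmatrix}R_i\begin{bmatrix}I_n\\0\end{bmatrix}+\begin{bmatrix}\delta M^\top\\0\end{bmatrix}\right)^\top&\mathrm{sym}(M)-Q_i\end{bmatrix}\succ0\quad\text{for all }(i,j)\in\mathcal I\times\mathcal I,$$ $$Z_0R_i=\begin{bmatrix}M&0\\C_1&C_2\end{bmatrix}\quad\text{for all }i\in\mathcal I.$$ Then the origin of the closed-loop system $$x_{t+1}=(A+BK(x_t))Z(x_t),\qquad K(x)=\sum_{i=1}^N\alpha_i(x)K_i,\qquad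 K_i=U_0R_i\begin{bmatrix}M&0\\C_1&C_2\end{bmatrix}^{-1},$$ is locally asymptotically stable. A Lyapunov function for the closed-loop system is given by $V(x_t)=x_t^\top P(x_t)x_t$ with $P(x_t)=\sum_{i=1}^N\alpha_i(x_t)Q_i^{-1}$. Furthermore, if $\mathcal X=\mathbb R^n$, then the origin is globally asymptotically stable.
   Context: System and basis functions: $x_t\in\mathbb R^n$, $u_t\in\mathbb R^m$, $B\in\mathbb R^{n\times m}$. The function $f:\mathbb R^n\to\mathbb R^n$ is continuous, $f(0)=0$, and $f(x)=AZ(x)$ with $A\in\mathbb R^{n\times S}$ and $Z:\mathbb R^n\to\mathbb R^S$ continuous, $Z(0)=0$, of the form $Z(x)=\begin{bmatrix}x^\top&\underline Z(x)^\top\end{bmatrix}^\top$ with $\underline Z:\mathbb R^n\to\mathbb R^{S-n}$. ($A$ and $B$ are unknown to the designer.) Data: input-state data $\{u^d_k,x^d_k\}_{k=0}^T$ with $x^d_{k+1}=AZ(x^d_k)+Bu^d_k$ are arranged as $U_0=[u^d_0\ \cdots\ u^d_{T-1}]\in\mathbb R^{m\times T}$, $Z_0=[Z(x^d_0)\ \cdots\ Z(x^d_{T-1})]\in\mathbb R^{S\times T}$, $X_1=[x^d_1\ \cdots\ x^d_T]\in\mathbb R^{n\times T}$, so $X_1=AZ_0+BU_0$. Assumption on $L$: there is a function $L:\mathbb R^n\to\mathbb R^{(S-n)\times S}$ such that for all $x\in\mathcal X\subseteq\mathbb R^n$, where $0\in\mathrm{int}(\mathcal X)$: (i) $L(x)Z(x)=0$;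 (ii) $L(x)=\begin{bmatrix}L_1(x)&L_2(x)\end{bmatrix}$ with $L_2(x)\in\mathbb R^{(S-n)\times(S-n)}$ invertible; (iii) $L(x)=\sum_{i=1}^N\alpha_i(x)\mathcal L_i$ with $\mathcal L_i=L(v_i)$ for some $v_i\in\mathcal X$, where the $\alpha_i$ are continuous functions of $x\in\mathbb R^n$ satisfying $\alpha_i(x)\ge0$ and $\sum_{i=1}^N\alpha_i(x)=1$ (for $x\in\mathcal X$). Notation: $\mathrm{sym}(M)=M+M^\top$ for square $M$; $\star$ denotes the block determined by symmetry; $\succ0$ means symmetric positive definite. *)

theory Defs
  imports "HOL-Analysis.Analysis"
begin

(* Block vectors and matrices are indexed by sum types: the index type 'n + 'p
   stands for {1..S} with S = CARD('n) + CARD('p), the Inl-indices being the first n. *)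

definition vec_append :: "'a^'n \<Rightarrow> 'a^'p \<Rightarrow> 'a^('n + 'p)" where
  "vec_append x y = (\<chi> i. case i of Inl k \<Rightarrow> x $ k | Inr k \<Rightarrow> y $ k)"

definition row_block :: "'a^'c^'r \<Rightarrow> 'a^'d^'r \<Rightarrow> 'a^('c + 'd)^'r" where
  "row_block A B = (\<chi> i. vec_append (A $ i) (B $ i))"

definition col_block :: "'a^'c^'r \<Rightarrow> 'a^'c^'q \<Rightarrow> 'a^'c^('r + 'q)" where
  "col_block A B = vec_append A B"

definition block_mat ::
  "'a^'c^'r \<Rightarrow> 'a^'d^'r \<Rightarrow> 'a^'c^'q \<Rightarrow> 'a^'d^'q \<Rightarrow> 'a^('c + 'd)^('r + 'q)" where
  "block_mat A B C D = col_block (row_block A B) (row_block C D)"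

(* [A, *; C, D], where * is the transpose of C *)
definition star_block_mat :: "'a^'r^'r \<Rightarrow> 'a^'r^'q \<Rightarrow> 'a^'q^'q \<Rightarrow> 'a^('r + 'q)^('r + 'q)" where
  "star_block_mat A C D = block_mat A (transpose C) C D"

(* M + M^T, without a factor 1/2 *)
definition sym_mat :: "real^'n^'n \<Rightarrow> real^'n^'n" where
  "sym_mat M = M + transpose M"

definition pos_def :: "real^'n^'n \<Rightarrow> bool" where
  "pos_def P \<longleftrightarrow> transpose P = P \<and> (\<forall>x. x \<noteq> 0 \<longrightarrow> x \<bullet> (P *v x) > 0)"

(* The matrix with columns w 0, ..., w (T - 1), where T = CARD('t) and
   e :: 't => nat enumerates the columns, i.e. is a bijection onto {0..<T}. *)
definition data_matrix :: "('t \<Rightarrow> nat) \<Rightarrow> (nat \<Rightarrow> real^'r) \<Rightarrow> real^'t^'r" where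
  "data_matrix e w = (\<chi> i t. w (e t) $ i)"

definition trajectory :: "('a \<Rightarrow> 'a) \<Rightarrow> (nat \<Rightarrow> 'a) \<Rightarrow> bool" where
  "trajectory g x \<longleftrightarrow> (\<forall>t. x (Suc t) = g (x t))"

definition lyapunov_stable :: "('a::metric_space \<Rightarrow> 'a) \<Rightarrow> 'a \<Rightarrow> bool" where
  "lyapunov_stable g xe \<longleftrightarrow> g xe = xe \<and>
     (\<forall>\<epsilon>>0. \<exists>r>0. \<forall>x. trajectory g x \<and> dist (x 0) xe < r \<longrightarrow> (\<forall>t. dist (x t) xe < \<epsilon>))"

definition locally_asymptotically_stable :: "('a::metric_space \<Rightarrow> 'a) \<Rightarrow> 'a \<Rightarrow> bool" where
  "locally_asymptotically_stable g xe \<longleftrightarrow> lyapunov_stable g xe \<and>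
     (\<exists>r>0. \<forall>x. trajectory g x \<and> dist (x 0) xe < r \<longrightarrow> x \<longlonglongrightarrow> xe)"

definition globally_asymptotically_stable :: "('a::metric_space \<Rightarrow> 'a) \<Rightarrow> 'a \<Rightarrow> bool" where
  "globally_asymptotically_stable g xe \<longleftrightarrow> lyapunov_stable g xe \<and>
     (\<forall>x. trajectory g x \<longrightarrow> x \<longlonglongrightarrow> xe)"

(* D need not be invariant under g, so V is also evaluated outside D in the decrease condition. *)
definition lyapunov_function_on ::
  "'a::metric_space set \<Rightarrow> ('a \<Rightarrow> 'a) \<Rightarrow> 'a \<Rightarrow> ('a \<Rightarrow> real) \<Rightarrow> bool" where
  "lyapunov_function_on D g xe V \<longleftrightarrow> open D \<and> xe \<in> D \<and> continuous_on D V \<and> V xe = 0 \<and>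
     (\<forall>x\<in>D - {xe}. V x > 0) \<and> (\<forall>x\<in>D - {xe}. V (g x) - V x < 0)"

end

theory Submission
  imports Defs
begin

text \<open>
  Write \<open>y\<close> for the successor of \<open>x \<noteq> 0\<close> and \<open>G\<close> for the common value of \<open>Z0 ** R i\<close>, so that
  \<open>X1 ** R i = (A + B ** Ki i) ** G\<close>. Average the quadratic forms of the matrix inequalities
  over \<open>i\<close> with the weights \<open>\<alpha> i x\<close>, and evaluate the average at \<open>(\<xi>, \<zeta>, h - \<delta> *\<^sub>R \<xi>)\<close>, where
  \<open>(h, \<zeta>)\<close> solves \<open>G *v (h, \<zeta>) = Z x\<close>. The annihilator \<open>L x\<close> removes the terms with \<open>\<zeta>\<close>; the
  terms in \<open>\<eta> = h - \<delta> *\<^sub>R \<xi>\<close> are \<open>2 * (\<eta> \<bullet> x) - \<eta> \<bullet> (Q i *v \<eta>)\<close>, which is at most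
  \<open>x \<bullet> (matrix_inv (Q i) *v x)\<close>. Choosing \<open>\<xi> = - matrix_inv (Q j) *v y\<close> leaves
  \<open>y \<bullet> (matrix_inv (Q j) *v y) < V x\<close> for every \<open>j\<close>, and averaging over \<open>j\<close> with the weights
  \<open>\<alpha> j y\<close> gives \<open>V y < V x\<close> whenever \<open>y \<in> X\<close>.
\<close>

section \<open>Block vectors and block matrices\<close>

lemma vec_append_inner:
  fixes x u :: "real^'n::finite" and y w :: "real^'p::finite"
  shows "vec_append x y \<bullet> vec_append u w = x \<bullet> u + y \<bullet> w"
  by (simp add: inner_vec_def vec_append_def UNIV_Plus_UNIV[symmetric] sum.Plus del: UNIV_Plus_UNIV)

lemma vec_append_add:
  fixes x u :: "real^'n" and y w :: "real^'p"
  shows "vec_append x y + vec_append u w = vec_append (x + u) (y + w)"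
  by (simp add: vec_append_def vec_eq_iff split: sum.split)

lemma vec_append_eq_iff: "vec_append x y = vec_append u w \<longleftrightarrow> x = u \<and> y = w"
  by (auto simp: vec_append_def vec_eq_iff split: sum.splits)

lemma vec_append_zero: "vec_append 0 0 = (0 :: real^('n::finite + 'p::finite))"
  by (simp add: vec_append_def vec_eq_iff split: sum.split)

lemma vec_append_cases:
  obtains x y where "z = vec_append x y"
proof
  show "z = vec_append (\<chi> i. z $ Inl i) (\<chi> i. z $ Inr i)"
    by (simp add: vec_append_def vec_eq_iff split: sum.split)
qed

lemma col_block_mult_vec:
  fixes A :: "real^'c::finite^'r" and B :: "real^'c^'q"
  shows "col_block A B *v x = vec_append (A *v x) (B *v x)"
  by (simp add: col_block_def vec_append_def matrix_vector_mult_def vec_eq_iff split: sum.split)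

lemma row_block_mult_vec:
  fixes A :: "real^'c::finite^'r" and B :: "real^'d::finite^'r"
  shows "row_block A B *v vec_append x y = A *v x + B *v y"
  by (simp add: row_block_def vec_append_def matrix_vector_mult_def vec_eq_iff
      UNIV_Plus_UNIV[symmetric] sum.Plus del: UNIV_Plus_UNIV)

lemma block_mat_mult_vec:
  fixes A :: "real^'c::finite^'r" and B :: "real^'d::finite^'r"
    and C :: "real^'c^'q" and D :: "real^'d^'q"
  shows "block_mat A B C D *v vec_append x y = vec_append (A *v x + B *v y) (C *v x + D *v y)"
  by (simp add: block_mat_def col_block_mult_vec row_block_mult_vec)

lemma col_block_mult:
  fixes A :: "real^'c::finite^'r" and B :: "real^'c^'q" and C :: "real^'d^'c"
  shows "col_block A B ** C = col_block (A ** C) (B ** C)"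
  by (simp add: col_block_def vec_append_def matrix_matrix_mult_def vec_eq_iff split: sum.split)

section \<open>Quadratic forms of symmetrised and block matrices\<close>

lemma inner_transpose_mult:
  fixes A :: "real^'n::finite^'m::finite"
  shows "x \<bullet> (transpose A *v y) = (A *v x) \<bullet> y"
  by (metis dot_lmul_matrix transpose_matrix_vector inner_commute)

text \<open>As a simp rule it turns \<open>transpose A *v y\<close> into \<open>y v* A\<close>, a
  form that \<open>inner_transpose_mult\<close> does not match.\<close>

declare transpose_matrix_vector [simp del]

lemma sym_mat_quadratic_form:
  fixes M :: "real^'n::finite^'n"
  shows "x \<bullet> (sym_mat M *v x) = 2 * (x \<bullet> (M *v x))"
  by (simp add: sym_mat_def matrix_vector_mult_add_rdistrib inner_add_right inner_transpose_mult
      inner_commute)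

lemma star_block_mat_quadratic_form:
  fixes S :: "real^'r::finite^'r" and C :: "real^'r^'q::finite" and D :: "real^'q^'q"
  shows "vec_append x y \<bullet> (star_block_mat S C D *v vec_append x y)
    = x \<bullet> (S *v x) + 2 * (y \<bullet> (C *v x)) + y \<bullet> (D *v y)"
  by (simp add: star_block_mat_def block_mat_mult_vec vec_append_inner inner_add_right
      inner_transpose_mult inner_commute)

lemma matrix_vector_mult_sum_left:
  fixes F :: "'i \<Rightarrow> real^'n::finite^'m"
  shows "(\<Sum>i\<in>I. c i *\<^sub>R F i) *v x = (\<Sum>i\<in>I. c i *\<^sub>R (F i *v x))"
  by (induction I rule: infinite_finite_induct)
    (simp_all add: matrix_vector_mult_add_rdistrib scaleR_matrix_vector_assoc)

lemma matrix_add_rdistrib: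
  fixes A B :: "'a::semiring_1^'n::finite^'m"
  shows "(A + B) ** C = A ** C + B ** C"
  by (simp add: matrix_matrix_mult_def vec_eq_iff distrib_right sum.distrib)

lemma matrix_mult_sum_right:
  fixes F :: "'i \<Rightarrow> real^'k::finite^'n::finite" and B :: "real^'n^'m"
  shows "B ** (\<Sum>i\<in>I. c i *\<^sub>R F i) = (\<Sum>i\<in>I. c i *\<^sub>R (B ** F i))"
proof (induction I rule: infinite_finite_induct)
  case (insert i I)
  then show ?case
    by (simp add: matrix_add_ldistrib matrix_scalar_ac scalar_matrix_assoc)
qed (simp_all add: matrix_matrix_mult_def zero_vec_def)

section \<open>Invertible and positive definite matrices\<close>

lemma invertible_iff_kernel:
  fixes A :: "real^'n::finite^'n"
  shows "invertible A \<longleftrightarrow> (\<forall>x. A *v x = 0 \<longrightarrow> x = 0)"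
  by (simp add: invertible_left_inverse matrix_left_invertible_ker)

lemma matrix_inv_inverse:
  assumes "invertible A"
  shows "A ** matrix_inv A = mat 1" "matrix_inv A ** A = mat 1"
  using someI_ex[OF assms[unfolded invertible_def]] by (simp_all add: matrix_inv_def)

lemma matrix_inv_mult_vec:
  fixes A :: "real^'n::finite^'n"
  assumes "invertible A"
  shows "A *v (matrix_inv A *v x) = x"
  by (simp add: assms matrix_vector_mul_assoc matrix_inv_inverse)

lemma pos_def_invertible: "pos_def P \<Longrightarrow> invertible P"
  unfolding pos_def_def invertible_iff_kernel by (metis inner_zero_right less_irrefl)

text \<open>Completing the square: expand the nonnegative form of \<open>P\<close> at
  \<open>y - q\<close>, where \<open>q = matrix_inv P *v x\<close>.\<close>

lemma pos_def_inverse_lower_bound: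
  fixes P :: "real^'n::finite^'n"
  assumes P: "pos_def P"
  shows "2 * (y \<bullet> x) - y \<bullet> (P *v y) \<le> x \<bullet> (matrix_inv P *v x)"
proof -
  define q where "q = matrix_inv P *v x"
  have Pq: "P *v q = x"
    unfolding q_def by (rule matrix_inv_mult_vec[OF pos_def_invertible[OF P]])
  have "0 \<le> (y - q) \<bullet> (P *v (y - q))"
    using P by (cases "y - q = 0") (auto simp: pos_def_def intro: less_imp_le)
  also have "\<dots> = y \<bullet> (P *v y) - y \<bullet> x - q \<bullet> (P *v y) + q \<bullet> x"
    by (simp add: matrix_vector_mult_diff_distrib Pq inner_diff_left inner_diff_right)
  also have "q \<bullet> (P *v y) = y \<bullet> x"
    using inner_transpose_mult[of q P y] P Pq by (simp add: pos_def_def inner_commute)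
  finally show ?thesis
    by (simp add: q_def inner_commute)
qed

text \<open>If k bounds the operator norm of \<open>P\<close>, then
  \<open>pos_def_inverse_lower_bound\<close> at y = x/k gives 2/k - k/k^2 = 1/k as the
  constant.\<close>

lemma pos_def_inverse_coercive:
  fixes P :: "real^'n::finite^'n"
  assumes P: "pos_def P"
  obtains c where "c > 0" "\<And>x. c * (norm x)\<^sup>2 \<le> x \<bullet> (matrix_inv P *v x)"
proof
  \<comment> \<open>The summand 1 makes \<open>k\<close> positive at once, so that dividing by it is
    safe.\<close>
  define k where "k = onorm ((*v) P) + 1"
  have bl: "bounded_linear ((*v) P)"
    by (rule matrix_vector_mul_bounded_linear)
  have k: "k > 0"
    using onorm_pos_le[OF bl] by (simp add: k_def)
  then show "1 / k > 0"
    by simp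
  fix x :: "real^'n"
  have "x \<bullet> (P *v x) \<le> norm x * norm (P *v x)"
    by (rule norm_cauchy_schwarz)
  also have "\<dots> \<le> norm x * (k * norm x)"
  proof (rule mult_left_mono)
    have "norm (P *v x) \<le> onorm ((*v) P) * norm x"
      by (rule onorm[OF bl])
    also have "\<dots> \<le> k * norm x"
      by (simp add: k_def mult_right_mono)
    finally show "norm (P *v x) \<le> k * norm x" .
  qed simp
  finally have "x \<bullet> (P *v x) \<le> k * (norm x)\<^sup>2"
    by (simp add: power2_eq_square mult_ac)
  then have "(1 / k)\<^sup>2 * (x \<bullet> (P *v x)) \<le> (1 / k)\<^sup>2 * (k * (norm x)\<^sup>2)"
    by (intro mult_left_mono) auto
  then have "(1 / k)\<^sup>2 * (x \<bullet> (P *v x)) \<le> 1 / k * (norm x)\<^sup>2"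
    using k by (simp add: power2_eq_square)
  moreover have "2 * (((1 / k) *\<^sub>R x) \<bullet> x) - ((1 / k) *\<^sub>R x) \<bullet> (P *v ((1 / k) *\<^sub>R x))
      \<le> x \<bullet> (matrix_inv P *v x)"
    by (rule pos_def_inverse_lower_bound[OF P])
  moreover have "((1 / k) *\<^sub>R x) \<bullet> (P *v ((1 / k) *\<^sub>R x)) = (1 / k)\<^sup>2 * (x \<bullet> (P *v x))"
    by (simp add: matrix_vector_mult_scaleR power2_eq_square)
  moreover have "((1 / k) *\<^sub>R x) \<bullet> x = 1 / k * (norm x)\<^sup>2"
    by (simp add: power2_norm_eq_inner)
  ultimately show "1 / k * (norm x)\<^sup>2 \<le> x \<bullet> (matrix_inv P *v x)"
    by linarith
qed

text \<open>Nonnegative weights with sum 1 cannot all vanish; one positive weight keeps the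
  inequality strict.\<close>

lemma weighted_average_greater:
  fixes c h :: "'i \<Rightarrow> real"
  assumes "\<And>i. i \<in> I \<Longrightarrow> c i \<ge> 0" "sum c I = 1" "\<And>i. i \<in> I \<Longrightarrow> h i > b"
  shows "(\<Sum>i\<in>I. c i * h i) > b"
proof -
  have fin: "finite I"
    using assms(2) by (metis sum.infinite zero_neq_one)
  obtain k where k: "k \<in> I" "c k > 0"
    using assms(1,2) by (metis less_eq_real_def sum.neutral zero_neq_one)
  have "(\<Sum>i\<in>I. c i * b) < (\<Sum>i\<in>I. c i * h i)"
  proof (rule sum_strict_mono_ex1[OF fin])
    show "\<forall>i\<in>I. c i * b \<le> c i * h i"
      using assms by (auto intro: mult_left_mono less_imp_le)
    show "\<exists>i\<in>I. c i * b < c i * h i"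
      using k assms(3)[OF k(1)] by (blast intro: mult_strict_left_mono)
  qed
  then show ?thesis
    using assms(2) by (simp flip: sum_distrib_right)
qed

section \<open>The matrix inequality as a quadratic form\<close>

text \<open>Evaluates the matrix inequality for one pair (i, j) at the block vector of \<xi>,
  \<zeta>, \<eta>. In the application \<open>F\<close> is \<open>A + B ** Ki i\<close> and \<Lambda>
  is \<open>Lv i\<close>. The choice of \<eta> makes all terms with \<open>W\<close> recombine into
  the image of \<open>z\<close>.\<close>

lemma lmi_quadratic_form:
  fixes F :: "real^('n::finite + 'p::finite)^'n" and \<Lambda> :: "real^('n + 'p)^'p"
    and M Qi Qj :: "real^'n^'n" and C1 :: "real^'n^'p" and C2 :: "real^'p^'p"
  defines "W \<equiv> col_block F \<Lambda> ** block_mat M 0 C1 C2"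
  assumes lmi: "pos_def (star_block_mat
        (sym_mat (W ** block_mat (\<delta> *\<^sub>R mat 1) 0 0 (mat 1)) + block_mat Qj 0 0 0)
        (transpose (W ** col_block (mat 1) 0 + col_block (\<delta> *\<^sub>R transpose M) 0))
        (sym_mat M - Qi))"
    and z: "block_mat M 0 C1 C2 *v vec_append h \<zeta> = z" and x: "M *v h = x" "x \<noteq> 0"
    and \<eta>: "\<eta> = h - \<delta> *\<^sub>R \<xi>"
  shows "2 * (\<xi> \<bullet> (F *v z)) + 2 * (\<zeta> \<bullet> (\<Lambda> *v z)) + \<xi> \<bullet> (Qj *v \<xi>) + 2 * (\<eta> \<bullet> x) - \<eta> \<bullet> (Qi *v \<eta>) > 0"
proof -
  let ?w = "vec_append \<xi> \<zeta>"
  have Wv: "W *v vec_append a b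
      = vec_append (F *v (block_mat M 0 C1 C2 *v vec_append a b))
          (\<Lambda> *v (block_mat M 0 C1 C2 *v vec_append a b))" for a b
    by (simp add: W_def col_block_mult_vec flip: matrix_vector_mul_assoc)
  \<comment> \<open>If both vanished, then \<open>h = 0\<close> and hence
    \<open>x = M *v h = 0\<close>.\<close>
  have "\<not> (\<xi> = 0 \<and> \<eta> = 0)"
    using x \<eta> by auto
  then have "vec_append ?w \<eta> \<noteq> 0"
    by (metis vec_append_eq_iff vec_append_zero)
  then have pos: "0 < vec_append ?w \<eta> \<bullet> (star_block_mat
        (sym_mat (W ** block_mat (\<delta> *\<^sub>R mat 1) 0 0 (mat 1)) + block_mat Qj 0 0 0)
        (transpose (W ** col_block (mat 1) 0 + col_block (\<delta> *\<^sub>R transpose M) 0))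
        (sym_mat M - Qi) *v vec_append ?w \<eta>)"
    using lmi by (simp add: pos_def_def)
  have D: "?w \<bullet> ((W ** block_mat (\<delta> *\<^sub>R mat 1) 0 0 (mat 1)) *v ?w) = ?w \<bullet> (W *v vec_append (\<delta> *\<^sub>R \<xi>) \<zeta>)"
    by (simp add: block_mat_mult_vec flip: matrix_vector_mul_assoc scaleR_matrix_vector_assoc)
  have E: "\<eta> \<bullet> (transpose (W ** col_block (mat 1) 0 + col_block (\<delta> *\<^sub>R transpose M) 0) *v ?w)
      = ?w \<bullet> (W *v vec_append \<eta> 0) + \<delta> * (\<eta> \<bullet> (M *v \<xi>))"
  proof -
    have "col_block (\<delta> *\<^sub>R transpose M) 0 *v \<eta> = vec_append (\<delta> *\<^sub>R (transpose M *v \<eta>)) (0::real^'p)"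
      by (simp add: col_block_mult_vec flip: scaleR_matrix_vector_assoc)
    moreover have "(W ** col_block (mat 1) 0) *v \<eta> = W *v vec_append \<eta> 0"
      by (simp add: col_block_mult_vec flip: matrix_vector_mul_assoc)
    ultimately show ?thesis
      unfolding inner_transpose_mult
      by (simp add: matrix_vector_mult_add_rdistrib inner_add_left vec_append_inner
          inner_commute[of _ \<xi>] inner_transpose_mult inner_commute[of "W *v _"] inner_commute[of "M *v \<xi>"])
  qed
  \<comment> \<open>The first argument of \<open>W\<close> comes from the diagonal block, the second
    from the off-diagonal one; their sum is the preimage of \<open>z\<close>.\<close>
  have "vec_append (\<delta> *\<^sub>R \<xi>) \<zeta> + vec_append \<eta> 0 = vec_append h \<zeta>"
    by (simp add: vec_append_add \<eta>)
  then have "W *v vec_append (\<delta> *\<^sub>R \<xi>) \<zeta> + W *v vec_append \<eta> 0 = W *v vec_append h \<zeta>"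
    by (metis matrix_vector_right_distrib)
  then have sum: "?w \<bullet> (W *v vec_append (\<delta> *\<^sub>R \<xi>) \<zeta>) + ?w \<bullet> (W *v vec_append \<eta> 0)
      = \<xi> \<bullet> (F *v z) + \<zeta> \<bullet> (\<Lambda> *v z)"
    unfolding inner_add_right[symmetric] by (simp add: Wv z vec_append_inner)
  \<comment> \<open>The same recombination for the terms with \<open>M\<close>: the two arguments of
    \<open>M\<close> add up to \<open>h\<close>, and \<open>M *v h = x\<close>.\<close>
  have "\<eta> \<bullet> (M *v \<eta>) + \<delta> * (\<eta> \<bullet> (M *v \<xi>)) = \<eta> \<bullet> x"
    using x by (simp add: \<eta> matrix_vector_mult_diff_distrib matrix_vector_mult_scaleR
        inner_diff_left inner_diff_right algebra_simps)
  with pos sum show ?thesis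
    by (simp add: star_block_mat_quadratic_form matrix_vector_mult_add_rdistrib inner_add_right
        sym_mat_quadratic_form D E matrix_vector_mult_diff_rdistrib inner_diff_right
        block_mat_mult_vec vec_append_inner)
qed

lemma pos_def_star_block_mat_lower_right:
  fixes D :: "real^'q::finite^'q"
  assumes "pos_def (star_block_mat S C D)" "y \<noteq> 0"
  shows "y \<bullet> (D *v y) > 0"
  using assms star_block_mat_quadratic_form[of 0 y S C D]
  by (simp add: pos_def_def) (metis vec_append_eq_iff vec_append_zero)

text \<open>On a nonzero kernel vector of \<open>M\<close> the form of \<open>sym_mat M - Q\<close>
  would reduce to that of \<open>-Q\<close>, which is negative.\<close>

lemma sym_mat_minus_pos_imp_invertible:
  fixes M :: "real^'n::finite^'n"
  assumes "pos_def Q" "\<And>y. y \<noteq> 0 \<Longrightarrow> y \<bullet> ((sym_mat M - Q) *v y) > 0"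
  shows "invertible M"
  unfolding invertible_iff_kernel
proof (intro allI impI, rule ccontr)
  fix y assume "M *v y = 0" "y \<noteq> 0"
  with assms(2)[of y] assms(1) show False
    by (simp add: pos_def_def matrix_vector_mult_diff_rdistrib inner_diff_right sym_mat_quadratic_form)
      (metis less_asym)
qed

lemma invertible_block_lower_triangular:
  fixes M :: "real^'n::finite^'n" and C2 :: "real^'p::finite^'p"
  assumes "invertible M" "invertible C2"
  shows "invertible (block_mat M 0 C1 C2)"
  unfolding invertible_iff_kernel
proof (intro allI impI)
  fix w assume w: "block_mat M 0 C1 C2 *v w = 0"
  obtain a b where ab: "w = vec_append a b"
    by (rule vec_append_cases)
  have "M *v a = 0 \<and> C1 *v a + C2 *v b = 0"
    using w vec_append_eq_iff by (fastforce simp: ab block_mat_mult_vec simp flip: vec_append_zero)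
  then have "a = 0 \<and> b = 0"
    using assms by (auto simp: invertible_iff_kernel)
  then show "w = 0"
    by (simp add: ab vec_append_zero)
qed

section \<open>Lyapunov theory in discrete time\<close>

lemma trajectory_sublevel:
  assumes "trajectory g x" "\<And>y. y \<noteq> xe \<Longrightarrow> V (g y) < (V y :: real)" "g xe = xe"
  shows "V (x t) \<le> V (x 0)"
proof (induction t)
  case (Suc t)
  have "V (g (x t)) \<le> V (x t)"
    using assms(2)[of "x t"] assms(3) by (cases "x t = xe") auto
  with Suc show ?case
    using assms(1) by (simp add: trajectory_def)
qed simp

text \<open>A discrete trajectory can jump over a sphere, so the barrier is a closed shell
  \<open>S\<close>. It is thick enough that one step from inside it cannot pass beyond it, and a
  state with V below its minimum on \<open>S\<close> cannot land in it.\<close>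

lemma lyapunov_function_imp_stable:
  fixes g :: "'a::heine_borel \<Rightarrow> 'a"
  assumes V: "lyapunov_function_on D g xe V" and g: "continuous_on UNIV g" and fixpt: "g xe = xe"
  shows "lyapunov_stable g xe"
  unfolding lyapunov_stable_def
proof (intro conjI allI impI fixpt)
  fix \<epsilon> :: real assume "\<epsilon> > 0"
  have D: "open D" "xe \<in> D" and Vc: "continuous_on D V" and V0: "V xe = 0"
    and Vpos: "\<And>x. x \<in> D \<Longrightarrow> x \<noteq> xe \<Longrightarrow> V x > 0"
    and Vdec: "\<And>x. x \<in> D \<Longrightarrow> x \<noteq> xe \<Longrightarrow> V (g x) < V x"
    using V by (auto simp: lyapunov_function_on_def)
  obtain e where e: "e > 0" "cball xe e \<subseteq> D"
    using D open_contains_cball by blast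
  \<comment> \<open>Halving \<epsilon> puts even the closed ball of radius \<open>a\<close> strictly
    within distance \<epsilon>.\<close>
  define a where "a = min e (\<epsilon> / 2)"
  have a: "a > 0" "cball xe a \<subseteq> D" "a < \<epsilon>"
    using e \<open>\<epsilon> > 0\<close> by (auto simp: a_def)
  \<comment> \<open>Continuity of \<open>g\<close> supplies the inner radius: one step from the ball
    of radius \<open>b\<close> stays within radius \<open>a\<close>.\<close>
  have "open (g -` ball xe a)"
    using g by (simp add: continuous_on_open_vimage open_vimage)
  moreover have "xe \<in> g -` ball xe a"
    using a fixpt by simp
  ultimately obtain b0 where b0: "b0 > 0" "ball xe b0 \<subseteq> g -` ball xe a"
    by (meson open_contains_ball)
  define b where "b = min b0 a"
  have b: "b > 0" "b \<le> a" "\<And>x. dist x xe < b \<Longrightarrow> dist (g x) xe < a"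
    using b0 a by (auto simp: b_def dist_commute subset_iff)
  define S where "S = cball xe a - ball xe b"
  have S: "compact S" "S \<subseteq> D" "xe \<notin> S"
    using a b by (auto simp: S_def intro: compact_diff)
  obtain m where m: "m > 0" "\<And>x. x \<in> S \<Longrightarrow> m \<le> V x"
  proof (cases "S = {}")
    case True
    then show ?thesis
      using that[of 1] by simp
  next
    case False
    then obtain s where "s \<in> S" "\<And>x. x \<in> S \<Longrightarrow> V s \<le> V x"
      using continuous_attains_inf[OF S(1) False] continuous_on_subset[OF Vc S(2)] by blast
    then show ?thesis
      using that[of "V s"] Vpos S by auto
  qed
  have "isCont V xe"
    using Vc D by (simp add: continuous_on_eq_continuous_at)
  then obtain c0 where c0: "c0 > 0" "\<And>x. dist x xe < c0 \<Longrightarrow> dist (V x) (V xe) < m"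
    using m(1) unfolding continuous_at_eps_delta by blast
  define c where "c = min c0 b"
  have "dist (x t) xe < \<epsilon>" if "trajectory g x" "dist (x 0) xe < c" for x t
  proof -
    \<comment> \<open>Both conjuncts are needed in the induction: the first confines the next state
      to the ball of radius \<open>a\<close>, the second keeps it out of \<open>S\<close>, hence
      again within radius \<open>b\<close>.\<close>
    have "dist (x t) xe < b \<and> V (x t) < m"
    proof (induction t)
      case 0
      show ?case
        using that(2) c0(2)[of "x 0"] V0 by (auto simp: c_def dist_real_def)
    next
      case (Suc t)
      have gx: "x (Suc t) = g (x t)"
        using that(1) by (simp add: trajectory_def)
      have in_a: "dist (g (x t)) xe < a"
        using Suc b by blast
      have "x t \<in> D"
        using Suc a(2) b(2) by (auto simp: dist_commute subset_iff)
      then have "V (g (x t)) \<le> V (x t)"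
        using Vdec[of "x t"] fixpt by (cases "x t = xe") auto
      then have lt: "V (g (x t)) < m"
        using Suc by linarith
      then have "g (x t) \<notin> S"
        using m(2) by fastforce
      then show ?case
        using in_a lt by (simp add: S_def gx dist_commute)
    qed
    then show ?thesis
      using a b by linarith
  qed
  moreover have "c > 0"
    using c0 b by (simp add: c_def)
  ultimately show "\<exists>r>0. \<forall>x. trajectory g x \<and> dist (x 0) xe < r \<longrightarrow> (\<forall>t. dist (x t) xe < \<epsilon>)"
    by blast
qed

text \<open>A limit point \<open>y\<close> of the trajectory satisfies \<open>V (g y) = V y\<close>, hence is the equilibrium;
  stability then upgrades the limit point to a limit.\<close>

lemma lyapunov_function_imp_convergent:
  fixes g :: "'a::heine_borel \<Rightarrow> 'a"
  assumes V: "lyapunov_function_on D g xe V" and g: "continuous_on UNIV g"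
    and stable: "lyapunov_stable g xe"
    and x: "trajectory g x" and S: "compact S" "S \<subseteq> D" "\<And>t. x t \<in> S"
  shows "x \<longlonglongrightarrow> xe"
proof -
  have D: "open D" "xe \<in> D" and Vc: "continuous_on D V" and V0: "V xe = 0"
    and Vpos: "\<And>x. x \<in> D \<Longrightarrow> x \<noteq> xe \<Longrightarrow> V x > 0"
    and Vdec: "\<And>x. x \<in> D \<Longrightarrow> x \<noteq> xe \<Longrightarrow> V (g x) < V x"
    using V by (auto simp: lyapunov_function_on_def)
  have step: "x (Suc t) = g (x t)" for t
    using x by (simp add: trajectory_def)
  have fixpt: "g xe = xe"
    using stable by (simp add: lyapunov_stable_def)
  have "V (x (Suc t)) \<le> V (x t)" for t
    using Vdec[of "x t"] S(2) S(3)[of t] fixpt by (cases "x t = xe") (auto simp: step)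
  then have "decseq (\<lambda>t. V (x t))"
    by (simp add: decseq_Suc_iff)
  moreover have "0 \<le> V (x t)" for t
    using Vpos[of "x t"] S V0 by (cases "x t = xe") (auto intro: less_imp_le)
  ultimately obtain c where c: "(\<lambda>t. V (x t)) \<longlonglongrightarrow> c"
    using decseq_convergent by metis
  obtain y r where y: "y \<in> S" "strict_mono r" "(x \<circ> r) \<longlonglongrightarrow> y"
    using S(1,3) unfolding compact_eq_seq_compact_metric seq_compact_def by blast
  have gxr: "(\<lambda>t. x (Suc (r t))) \<longlonglongrightarrow> g y"
    using continuous_on_tendsto_compose[OF g y(3)] by (simp add: step)
  have gy: "g y \<in> S"
    using closed_sequentially[OF compact_imp_closed[OF S(1)] _ gxr] S(3) by simp
  have isCont_V: "isCont V z" if "z \<in> S" for z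
    using Vc D(1) S(2) that by (auto simp: continuous_on_eq_continuous_at)
  have "(\<lambda>t. V ((x \<circ> r) t)) \<longlonglongrightarrow> V y"
    by (rule isCont_tendsto_compose[OF isCont_V[OF y(1)] y(3)])
  moreover have "(\<lambda>t. V ((x \<circ> r) t)) \<longlonglongrightarrow> c"
    using LIMSEQ_subseq_LIMSEQ[OF c y(2)] by (simp add: o_def)
  ultimately have "V y = c"
    using LIMSEQ_unique by blast
  moreover have "(\<lambda>t. V (x (Suc (r t)))) \<longlonglongrightarrow> V (g y)"
    by (rule isCont_tendsto_compose[OF isCont_V[OF gy] gxr])
  moreover have "(\<lambda>t. V (x (Suc (r t)))) \<longlonglongrightarrow> c"
    using LIMSEQ_subseq_LIMSEQ[OF LIMSEQ_Suc[OF c] y(2)] by (simp add: o_def)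
  ultimately have "V (g y) = V y"
    using LIMSEQ_unique by blast
  then have y_xe: "y = xe"
    using Vdec[of y] y(1) S(2) by force
  show ?thesis
  proof (rule metric_LIMSEQ_I)
    fix \<epsilon> :: real assume "\<epsilon> > 0"
    then obtain d where d: "d > 0"
      "\<And>x. trajectory g x \<Longrightarrow> dist (x 0) xe < d \<Longrightarrow> \<forall>t. dist (x t) xe < \<epsilon>"
      using stable unfolding lyapunov_stable_def by meson
    obtain k where k: "dist (x (r k)) xe < d"
      using metric_LIMSEQ_D[OF y(3) d(1)] y_xe by auto
    \<comment> \<open>The dynamics do not depend on time, so stability applies to the trajectory
      restarted at time \<open>r k\<close>.\<close>
    have "trajectory g (\<lambda>t. x (t + r k))"
      using step by (simp add: trajectory_def)
    from d(2)[OF this] k have near: "dist (x (t + r k)) xe < \<epsilon>" for t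
      by simp
    have "dist (x n) xe < \<epsilon>" if "n \<ge> r k" for n
      using near[of "n - r k"] that by simp
    then show "\<exists>n0. \<forall>n\<ge>n0. dist (x n) xe < \<epsilon>"
      by blast
  qed
qed

text \<open>Stability traps nearby trajectories in a closed ball inside \<open>D\<close>, which is
  the compact set that \<open>lyapunov_function_imp_convergent\<close> asks for.\<close>

lemma lyapunov_function_imp_locally_asymptotically_stable:
  fixes g :: "'a::heine_borel \<Rightarrow> 'a"
  assumes V: "lyapunov_function_on D g xe V" and g: "continuous_on UNIV g" and fixpt: "g xe = xe"
  shows "locally_asymptotically_stable g xe"
proof -
  have stable: "lyapunov_stable g xe"
    by (rule lyapunov_function_imp_stable[OF assms])
  obtain e where e: "e > 0" "cball xe e \<subseteq> D"
    using V open_contains_cball unfolding lyapunov_function_on_def by blast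
  obtain r where r: "r > 0" "\<And>x t. trajectory g x \<Longrightarrow> dist (x 0) xe < r \<Longrightarrow> dist (x t) xe < e"
    using stable e(1) unfolding lyapunov_stable_def by meson
  have "x \<longlonglongrightarrow> xe" if "trajectory g x" "dist (x 0) xe < r" for x
  proof (rule lyapunov_function_imp_convergent[OF V g stable that(1) _ e(2)])
    show "x t \<in> cball xe e" for t
      using r(2)[OF that, of t] by (simp add: dist_commute)
  qed simp
  then show ?thesis
    using stable r(1) unfolding locally_asymptotically_stable_def by blast
qed

text \<open>Here the compact set is the sublevel set of \<open>V\<close> at the initial state, which
  no trajectory leaves.\<close>

lemma lyapunov_function_imp_globally_asymptotically_stable:
  fixes g :: "'a::heine_borel \<Rightarrow> 'a"
  assumes V: "lyapunov_function_on UNIV g xe V" and g: "continuous_on UNIV g" and fixpt: "g xe = xe"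
    and bounded: "\<And>b. bounded {x. V x \<le> b}"
  shows "globally_asymptotically_stable g xe"
proof -
  have stable: "lyapunov_stable g xe"
    by (rule lyapunov_function_imp_stable[OF V g fixpt])
  have "x \<longlonglongrightarrow> xe" if x: "trajectory g x" for x
  proof (rule lyapunov_function_imp_convergent[OF V g stable x])
    have "continuous_on UNIV V"
      using V by (simp add: lyapunov_function_on_def)
    then have "closed {y. V y \<le> V (x 0)}"
      by (intro closed_Collect_le) auto
    then show "compact {y. V y \<le> V (x 0)}"
      using bounded by (simp add: compact_eq_bounded_closed)
    show "x t \<in> {y. V y \<le> V (x 0)}" for t
      using V trajectory_sublevel[OF x _ fixpt, of V] by (simp add: lyapunov_function_on_def)
  qed simp
  then show ?thesis
    using stable by (simp add: globally_asymptotically_stable_def)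
qed

section \<open>Stability of the data-driven closed loop\<close>

theorem theorem5:
  fixes A :: "real^('n::finite + 'p::finite)^'n"
    and B :: "real^'m::finite^'n"
    and f :: "real^'n \<Rightarrow> real^'n"
    and Z :: "real^'n \<Rightarrow> real^('n + 'p)"
    and Zu :: "real^'n \<Rightarrow> real^'p"
    and e :: "'t::finite \<Rightarrow> nat"
    and ud :: "nat \<Rightarrow> real^'m" and xd :: "nat \<Rightarrow> real^'n"
    and U0 :: "real^'t^'m" and Z0 :: "real^'t^('n + 'p)" and X1 :: "real^'t^'n"
    and X :: "(real^'n) set"
    and L :: "real^'n \<Rightarrow> real^('n + 'p)^'p"
    and L1 :: "real^'n \<Rightarrow> real^'n^'p" and L2 :: "real^'n \<Rightarrow> real^'p^'p"
    and N :: nat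
    and \<alpha> :: "nat \<Rightarrow> real^'n \<Rightarrow> real" and v :: "nat \<Rightarrow> real^'n"
    and Lv :: "nat \<Rightarrow> real^('n + 'p)^'p"
    and \<delta> :: real
    and R :: "nat \<Rightarrow> real^('n + 'p)^'t"
    and Q :: "nat \<Rightarrow> real^'n^'n"
    and M :: "real^'n^'n" and C1 :: "real^'n^'p" and C2 :: "real^'p^'p"
    and Ki :: "nat \<Rightarrow> real^('n + 'p)^'m" and K :: "real^'n \<Rightarrow> real^('n + 'p)^'m"
    and cl :: "real^'n \<Rightarrow> real^'n"
    and P :: "real^'n \<Rightarrow> real^'n^'n" and V :: "real^'n \<Rightarrow> real"
  assumes f_cont: "continuous_on UNIV f" and f_0: "f 0 = 0"
    and f_eq: "\<And>x. f x = A *v Z x"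
    and Z_cont: "continuous_on UNIV Z" and Z_0: "Z 0 = 0"
    and Z_eq: "\<And>x. Z x = vec_append x (Zu x)"
    and e_bij: "bij_betw e UNIV {0..<CARD('t)}"
    and data: "\<And>k. k < CARD('t) \<Longrightarrow> xd (Suc k) = f (xd k) + B *v ud k"
    and U0_eq: "U0 = data_matrix e ud"
    and Z0_eq: "Z0 = data_matrix e (\<lambda>k. Z (xd k))"
    and X1_eq: "X1 = data_matrix e (\<lambda>k. xd (Suc k))"
    and X_0: "0 \<in> interior X"
    and L_Z: "\<And>x. x \<in> X \<Longrightarrow> L x *v Z x = 0"
    and L_split: "\<And>x. x \<in> X \<Longrightarrow> L x = row_block (L1 x) (L2 x)"
    and L2_inv: "\<And>x. x \<in> X \<Longrightarrow> invertible (L2 x)"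
    and L_comb: "\<And>x. x \<in> X \<Longrightarrow> L x = (\<Sum>i=1..N. \<alpha> i x *\<^sub>R Lv i)"
    and v_in: "\<And>i. i \<in> {1..N} \<Longrightarrow> v i \<in> X"
    and Lv_eq: "\<And>i. i \<in> {1..N} \<Longrightarrow> Lv i = L (v i)"
    and \<alpha>_cont: "\<And>i. i \<in> {1..N} \<Longrightarrow> continuous_on UNIV (\<alpha> i)"
    and \<alpha>_nonneg: "\<And>i x. i \<in> {1..N} \<Longrightarrow> x \<in> X \<Longrightarrow> \<alpha> i x \<ge> 0"
    and \<alpha>_sum: "\<And>x. x \<in> X \<Longrightarrow> (\<Sum>i=1..N. \<alpha> i x) = 1"
    and Q_pd: "\<And>i. i \<in> {1..N} \<Longrightarrow> pos_def (Q i)"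
    and C2_inv: "invertible C2"
    and lmi: "\<And>i j. i \<in> {1..N} \<Longrightarrow> j \<in> {1..N} \<Longrightarrow>
      pos_def (star_block_mat
        (sym_mat (col_block X1 (Lv i ** Z0) ** R i ** block_mat (\<delta> *\<^sub>R mat 1) 0 0 (mat 1))
           + block_mat (Q j) 0 0 0)
        (transpose (col_block X1 (Lv i ** Z0) ** R i ** col_block (mat 1) 0
           + col_block (\<delta> *\<^sub>R transpose M) 0))
        (sym_mat M - Q i))"
    and Z0_R: "\<And>i. i \<in> {1..N} \<Longrightarrow> Z0 ** R i = block_mat M 0 C1 C2"
    and Ki_eq: "\<And>i. i \<in> {1..N} \<Longrightarrow> Ki i = U0 ** R i ** matrix_inv (block_mat M 0 C1 C2)"
    and K_eq: "\<And>x. K x = (\<Sum>i=1..N. \<alpha> i x *\<^sub>R Ki i)"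
    and cl_eq: "\<And>x. cl x = (A + B ** K x) *v Z x"
    and P_eq: "\<And>x. P x = (\<Sum>i=1..N. \<alpha> i x *\<^sub>R matrix_inv (Q i))"
    and V_eq: "\<And>x. V x = x \<bullet> (P x *v x)"
  shows "locally_asymptotically_stable cl 0
    \<and> (\<exists>D. D \<subseteq> X \<and> lyapunov_function_on D cl 0 V)
    \<and> (X = UNIV \<longrightarrow> globally_asymptotically_stable cl 0 \<and> lyapunov_function_on UNIV cl 0 V)"
proof -
  let ?I = "{1..N}" and ?G = "block_mat M 0 C1 C2"
  have zero_X: "0 \<in> X"
    using X_0 interior_subset by blast
  \<comment> \<open>For \<open>N = 0\<close> the weights at the origin would sum to 0 instead of
    1.\<close>
  then have "N \<ge> 1"
    using \<alpha>_sum[of 0] by (cases N) auto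
  then have one: "1 \<in> ?I"
    by simp
  have M_inv: "invertible M"
    using sym_mat_minus_pos_imp_invertible[OF Q_pd[OF one]
        pos_def_star_block_mat_lower_right[OF lmi[OF one one]]] by blast
  have G_inv: "invertible ?G"
    by (rule invertible_block_lower_triangular[OF M_inv C2_inv])
  have X1: "X1 = A ** Z0 + B ** U0"
  proof -
    have "e t < CARD('t)" for t
      using bij_betwE[OF e_bij] by simp
    then have "xd (Suc (e t)) = A *v Z (xd (e t)) + B *v ud (e t)" for t
      by (simp add: data f_eq)
    then show ?thesis
      by (simp add: X1_eq Z0_eq U0_eq data_matrix_def vec_eq_iff matrix_matrix_mult_def
          matrix_vector_mult_def)
  qed
  \<comment> \<open>This turns data into dynamics: \<open>X1 ** R i\<close> is
    \<open>A ** Z0 ** R i + B ** U0 ** R i\<close>, and the gain \<open>Ki i\<close> is chosen so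
    that \<open>Ki i ** ?G = U0 ** R i\<close>.\<close>
  have W: "col_block X1 (Lv i ** Z0) ** R i = col_block (A + B ** Ki i) (Lv i) ** ?G"
    if i: "i \<in> ?I" for i
  proof -
    have "Ki i ** ?G = U0 ** R i"
      by (simp add: Ki_eq[OF i] matrix_inv_inverse[OF G_inv] flip: matrix_mul_assoc)
    then show ?thesis
      by (simp add: col_block_mult X1 matrix_add_rdistrib Z0_R[OF i] flip: matrix_mul_assoc)
  qed
  have cl_0: "cl 0 = 0"
    by (simp add: cl_eq Z_0)
  have cl_sum: "cl x = A *v Z x + (\<Sum>i\<in>?I. \<alpha> i x *\<^sub>R (B *v (Ki i *v Z x)))" for x
    by (simp add: cl_eq K_eq matrix_mult_sum_right matrix_vector_mult_add_rdistrib
        matrix_vector_mult_sum_left matrix_vector_mul_assoc)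
  have cl_cont: "continuous_on UNIV cl"
    unfolding cl_sum[abs_def]
    by (intro continuous_intros \<alpha>_cont Z_cont
        bounded_linear.continuous_on[OF matrix_vector_mul_bounded_linear])
  have V_sum: "V x = (\<Sum>i\<in>?I. \<alpha> i x * (x \<bullet> (matrix_inv (Q i) *v x)))" for x
    by (simp add: V_eq P_eq matrix_vector_mult_sum_left inner_sum_right)
  have V_cont: "continuous_on UNIV V"
    unfolding V_sum[abs_def]
    by (intro continuous_intros \<alpha>_cont
        bounded_linear.continuous_on[OF matrix_vector_mul_bounded_linear])
  \<comment> \<open>Only the weights at \<open>x\<close> occur here; since j is arbitrary, those at
    \<open>cl x\<close> can be brought in afterwards.\<close>
  have step: "cl x \<bullet> (matrix_inv (Q j) *v cl x) < V x" if x: "x \<in> X" "x \<noteq> 0" and j: "j \<in> ?I" for x j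
  proof -
    obtain h \<zeta> where h: "?G *v vec_append h \<zeta> = Z x"
      using matrix_inv_mult_vec[OF G_inv, of "Z x"] vec_append_cases by metis
    have Mh: "M *v h = x"
      using h by (simp add: block_mat_mult_vec Z_eq vec_append_eq_iff)
    \<comment> \<open>This is the minimiser over \<xi> of 2 * (\<xi> \<bullet> \<open>cl x\<close>)
      + \<xi> \<bullet> (\<open>Q j *v\<close> \<xi>).\<close>
    define q where "q = matrix_inv (Q j) *v (- cl x)"
    have Qq: "Q j *v q = - cl x"
      unfolding q_def by (rule matrix_inv_mult_vec[OF pos_def_invertible[OF Q_pd[OF j]]])
    have q: "q = - (matrix_inv (Q j) *v cl x)"
      unfolding q_def by (rule linear_neg[OF matrix_vector_mul_linear])
    define \<eta> where "\<eta> = h - \<delta> *\<^sub>R q"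
    let ?F = "\<lambda>i. A + B ** Ki i"
    have "0 < 2 * (q \<bullet> (?F i *v Z x)) + 2 * (\<zeta> \<bullet> (Lv i *v Z x)) - q \<bullet> cl x
        + x \<bullet> (matrix_inv (Q i) *v x)" (is "0 < ?h i") if i: "i \<in> ?I" for i
      using lmi_quadratic_form[OF lmi[OF i j, unfolded W[OF i]] h Mh x(2) \<eta>_def]
        pos_def_inverse_lower_bound[OF Q_pd[OF i], of \<eta> x] Qq by simp
    then have "0 < (\<Sum>i\<in>?I. \<alpha> i x * ?h i)"
      by (intro weighted_average_greater \<alpha>_nonneg \<alpha>_sum x)
    also have "\<dots> = 2 * (q \<bullet> (\<Sum>i\<in>?I. \<alpha> i x *\<^sub>R (?F i *v Z x)))
        + 2 * (\<zeta> \<bullet> (\<Sum>i\<in>?I. \<alpha> i x *\<^sub>R (Lv i *v Z x))) + (\<Sum>i\<in>?I. \<alpha> i x) * (- q \<bullet> cl x) + V x"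
      by (simp add: V_sum inner_sum_right sum_distrib_left sum_distrib_right sum.distrib
          sum_subtractf sum_negf distrib_left right_diff_distrib mult.left_commute)
    \<comment> \<open>Because the weights at \<open>x\<close> sum to 1, averaging the N closed-loop
      matrices reproduces the scheduled gain \<open>K x\<close>.\<close>
    also have "(\<Sum>i\<in>?I. \<alpha> i x *\<^sub>R (?F i *v Z x)) = (\<Sum>i\<in>?I. \<alpha> i x) *\<^sub>R (A *v Z x)
        + (\<Sum>i\<in>?I. \<alpha> i x *\<^sub>R (B *v (Ki i *v Z x)))"
      by (simp add: matrix_vector_mult_add_rdistrib scaleR_add_right sum.distrib scaleR_left.sum
          matrix_vector_mul_assoc)
    also have "\<dots> = cl x"
      by (simp only: \<alpha>_sum[OF x(1)] cl_sum scaleR_one)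
    also have "(\<Sum>i\<in>?I. \<alpha> i x *\<^sub>R (Lv i *v Z x)) = 0"
      using L_Z[OF x(1)] by (simp add: L_comb[OF x(1)] matrix_vector_mult_sum_left)
    finally show ?thesis
      using \<alpha>_sum[OF x(1)] by (simp add: q inner_commute)
  qed
  \<comment> \<open>The averaging lemma gives strict lower bounds, so it is applied to the negated
    forms, with the weights at \<open>cl x\<close>.\<close>
  have V_dec: "V (cl x) < V x" if "x \<in> X" "x \<noteq> 0" "cl x \<in> X" for x
    using weighted_average_greater[of ?I "\<lambda>i. \<alpha> i (cl x)" "- V x"
        "\<lambda>i. - (cl x \<bullet> (matrix_inv (Q i) *v cl x))"] step that \<alpha>_nonneg \<alpha>_sum
    by (simp add: V_sum[of "cl x"] sum_negf)
  have "\<forall>i\<in>?I. \<exists>c>0. \<forall>x. c * (norm x)\<^sup>2 \<le> x \<bullet> (matrix_inv (Q i) *v x)"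
    using pos_def_inverse_coercive[OF Q_pd] by metis
  then obtain c where c: "\<And>i. i \<in> ?I \<Longrightarrow> c i > 0"
      "\<And>i x. i \<in> ?I \<Longrightarrow> c i * (norm x)\<^sup>2 \<le> x \<bullet> (matrix_inv (Q i) *v x)"
    by metis
  \<comment> \<open>A common coercivity constant survives averaging and bounds \<open>V\<close>
    below by a multiple of the squared norm on \<open>X\<close>.\<close>
  define c0 where "c0 = Min (c ` ?I)"
  have c0: "c0 > 0" "\<And>i. i \<in> ?I \<Longrightarrow> c0 \<le> c i"
    using c(1) one by (auto simp: c0_def)
  have V_ge: "c0 * (norm x)\<^sup>2 \<le> V x" if x: "x \<in> X" for x
  proof -
    have "c0 * (norm x)\<^sup>2 = (\<Sum>i\<in>?I. \<alpha> i x * (c0 * (norm x)\<^sup>2))"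
      using \<alpha>_sum[OF x] by (simp flip: sum_distrib_right)
    also have "\<dots> \<le> V x"
      unfolding V_sum
    proof (intro sum_mono mult_left_mono)
      fix i assume i: "i \<in> ?I"
      have "c0 * (norm x)\<^sup>2 \<le> c i * (norm x)\<^sup>2"
        using c0(2)[OF i] by (intro mult_right_mono) auto
      then show "c0 * (norm x)\<^sup>2 \<le> x \<bullet> (matrix_inv (Q i) *v x)"
        using c(2)[OF i] order_trans by blast
    qed (rule \<alpha>_nonneg[OF _ x])
    finally show ?thesis .
  qed
  \<comment> \<open>\<open>V_dec\<close> wants both \<open>x\<close> and \<open>cl x\<close> in
    \<open>X\<close>, where the weights are convex; as \<open>X\<close> may fail to be invariant,
    the preimage is intersected in. The origin belongs to \<open>D\<close> because \<open>cl\<close>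
    fixes it.\<close>
  define D where "D = interior X \<inter> cl -` interior X"
  have lyap: "lyapunov_function_on D cl 0 V"
    unfolding lyapunov_function_on_def
  proof (intro conjI ballI)
    show "open D"
      unfolding D_def using cl_cont by (intro open_Int open_interior open_vimage)
    show "0 \<in> D"
      using X_0 cl_0 by (simp add: D_def)
    show "continuous_on D V"
      using V_cont continuous_on_subset by blast
    show "V 0 = 0"
      by (simp add: V_eq)
    fix x assume "x \<in> D - {0}"
    then have x: "x \<in> X" "cl x \<in> X" "x \<noteq> 0"
      using interior_subset by (auto simp: D_def)
    have "c0 * (norm x)\<^sup>2 > 0"
      using c0(1) x(3) by simp
    then show "V x > 0"
      using V_ge[OF x(1)] by linarith
    show "V (cl x) - V x < 0"
      using V_dec x by simp
  qed
  have "D \<subseteq> X"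
    using interior_subset by (auto simp: D_def)
  moreover have "globally_asymptotically_stable cl 0 \<and> lyapunov_function_on UNIV cl 0 V"
    if "X = UNIV"
  proof
    show lyap_UNIV: "lyapunov_function_on UNIV cl 0 V"
      using lyap that by (simp add: D_def)
    show "globally_asymptotically_stable cl 0"
    proof (rule lyapunov_function_imp_globally_asymptotically_stable[OF lyap_UNIV cl_cont cl_0])
      fix b
      \<comment> \<open>With \<open>X = UNIV\<close> the quadratic lower bound on \<open>V\<close>
        holds everywhere, so sublevel sets are bounded.\<close>
      have "norm x \<le> sqrt (b / c0)" if "V x \<le> b" for x
      proof (rule real_le_rsqrt)
        have "c0 * (norm x)\<^sup>2 \<le> b"
          using V_ge[of x] \<open>X = UNIV\<close> that by simp
        then show "(norm x)\<^sup>2 \<le> b / c0"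
          using c0(1) by (simp add: pos_le_divide_eq mult.commute)
      qed
      then show "bounded {x. V x \<le> b}"
        unfolding bounded_iff by blast
    qed
  qed
  ultimately show ?thesis
    using lyapunov_function_imp_locally_asymptotically_stable[OF lyap cl_cont cl_0] lyap by blast
qed

end
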